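(* Let $M$ and $Q$ be independent random variables with $\mathbb{P}(M\ge 0,\,Q\ge 0)=1$, and let $R$ be the perpetuity generated by $(M,Q)$. Let $$q_+:=\operatorname{ess\,sup}Q\in(0,\infty)\qquad\text{and}\qquad f(x):=-x\log\mathbb{P}(M>1-1/x),\quad x>0,$$ and assume that $f\in\mathcal{R}_r$ with $r>1$. Then $$-\log\mathbb{P}(R>x)\sim\left(\frac{r}{r-1}\right)^{r-1}f\left(\frac{x}{q_+}\right)\qquad\text{as }x\to\infty.$$
   Context: Notation. $a(x)\sim b(x)$ means $\lim_{x\to\infty}a(x)/b(x)=1$. Regular variation: for $\rho\in\mathbb{R}$, $\mathcal{R}_\rho$ is the class of positive measurable functions $g$ defined in a neighbourhood of $+\infty$ with $\lim_{x\to\infty}g(tx)/g(x)=t^\rho$ for all $t>0$. (A function on a larger domain is said to be in $\mathcal{R}_\rho$ if its restriction to some neighbourhood of $+\infty$ is.) Perpetuity: the perpetuity $R$ generated by $(M,Q)$ is the (unique in law) random variable satisfying $R\stackrel{d}{=}MR+Q$ with $R$ and $(M,Q)$ independent on the right-hand side; equivalently $R\stackrel{d}{=}\sum_{j=1}^\infty Q_j\prod_{k=1}^{j-1}M_k$, where $(M_n,Q_n)_{n\ge1}$ are i.i.d. copies of $(M,Q)$. *)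

theory Defs
  imports "HOL-Probability.Probability" "HOL-Probability.Essential_Supremum"
    "HOL-Library.Landau_Symbols"
begin

definition regularly_varying :: "real \<Rightarrow> (real \<Rightarrow> real) \<Rightarrow> bool" where
  "regularly_varying \<rho> g \<longleftrightarrow>
     (\<exists>a. g \<in> borel_measurable (restrict_space borel {a<..}) \<and> (\<forall>x>a. g x > 0)) \<and>
     (\<forall>t>0. ((\<lambda>x. g (t * x) / g x) \<longlongrightarrow> t powr \<rho>) at_top)"

text \<open>
  \<open>is_perpetuity P M Q N R\<close>: the random variable \<open>R\<close> on \<open>N\<close> solves
  \<open>R =\<^sub>d M R + Q\<close>. The pair \<open>(M, Q)\<close> lives on \<open>P\<close>; on the product space the pair depends on
  the first coordinate only and \<open>R\<close> on the second only, which makes them independent on the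
  right-hand side.
\<close>
definition is_perpetuity ::
  "'a measure \<Rightarrow> ('a \<Rightarrow> real) \<Rightarrow> ('a \<Rightarrow> real) \<Rightarrow> 'b measure \<Rightarrow> ('b \<Rightarrow> real) \<Rightarrow> bool" where
  "is_perpetuity P M Q N R \<longleftrightarrow>
     prob_space P \<and> prob_space N \<and>
     M \<in> borel_measurable P \<and> Q \<in> borel_measurable P \<and> R \<in> borel_measurable N \<and>
     distr N borel R = distr (P \<Otimes>\<^sub>M N) borel (\<lambda>(\<omega>, \<omega>'). M \<omega> * R \<omega>' + Q \<omega>)"

text \<open>
  The function \<open>x \<mapsto> - x log \<P>(M > 1 - 1/x)\<close>, meant for \<open>x > 0\<close>. Where the probability is 0,
  mathematically the value is \<open>\<infinity>\<close>, whereas \<open>ln 0 = 0\<close> makes it 0 here; either way it is not a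
  positive real, so regular variation forces the probability to be positive for all large \<open>x\<close>.
\<close>
definition tail_fun :: "'a measure \<Rightarrow> ('a \<Rightarrow> real) \<Rightarrow> real \<Rightarrow> real" where
  "tail_fun P M x = - x * ln \<P>(\<omega> in P. M \<omega> > 1 - 1 / x)"

end

theory Submission
  imports Defs "HOL-Real_Asymp.Real_Asymp"
begin

text \<open>
  Put \<open>g x = - ln \<P>(M > 1 - 1/x)\<close>, so that \<open>f x = x * g x\<close>. This is a nondecreasing function that
  varies regularly with index \<open>\<rho> = r - 1 > 0\<close>, and \<open>G x = \<integral>\<^sub>0\<^sup>x g\<close> is asymptotic to \<open>f x / r\<close>.

  Read \<open>R = M R + Q\<close> as one step of a chain that starts at \<open>z\<close>. If \<open>M\<close> exceeds \<open>1 - 1/y\<close> and \<open>Q\<close> is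
  close to \<open>q\<close>, the chain climbs by about \<open>q - z/y\<close>; on the logarithmic scale this costs \<open>g y\<close>. With
  \<open>y = u * z / q\<close> every step climbs by the constant \<open>q * (1 - 1/u)\<close>, and climbing to \<open>x\<close> in this way
  costs the Riemann sum of \<open>z \<mapsto> g (u * z / q)\<close> with that mesh, which is about
  \<open>G (u * x / q) / (u - 1)\<close>, or \<open>u powr r / (u - 1) * f (x / q) / r\<close>. The factor
  \<open>u powr r / (u - 1)\<close> is smallest at \<open>u = r / (r - 1)\<close>, where its value is
  \<open>r * (r / (r - 1)) powr (r - 1)\<close>, called \<open>optimal_rate\<close> below. This heuristic gives the constant of
  the theorem. Both halves of the proof make it rigorous by using the fixed-point equation for the
  law of \<open>R\<close> only, without the series that represents \<open>R\<close>.

  \<^item> Following the strategy gives \<open>tail_climb\<close>, a recursive lower bound for \<open>\<P>(R > x)\<close>. Summation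
    (\<open>recursion_bound\<close>) turns it into an upper bound for \<open>- ln \<P>(R > x)\<close> (\<open>tail_exponent_upper\<close>).
  \<^item> No other strategy does better, because for \<open>0 < B < optimal_rate\<close> the function
    \<open>V z = exp (B * G (z / q))\<close> is a Lyapunov function: one step from a high level at least halves
    its mean (\<open>one_step_moment\<close>). Hence \<open>V R\<close> has finite mean and Markov's inequality bounds
    \<open>\<P>(R > x)\<close> by a multiple of \<open>exp (- B * G (x / q))\<close> (\<open>tail_upper\<close>).
\<close>

section \<open>Monotone regularly varying functions\<close>

text \<open>
  Monotonicity replaces the measurability in the definition of regular variation and yields
  integrability on bounded intervals.
\<close>
locale increasing_regvar =
  fixes g :: "real \<Rightarrow> real" and \<rho> :: real
  assumes mono_g: "mono g"
    and g_nonneg: "0 \<le> g x"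
    and g_pos: "eventually (\<lambda>x. 0 < g x) at_top"
    and index_pos: "0 < \<rho>"
    and regvar: "0 < t \<Longrightarrow> ((\<lambda>x. g (t * x) / g x) \<longlongrightarrow> t powr \<rho>) at_top"
begin

text \<open>
  Up to normalization this is the least cost of climbing to a level: \<open>g\<close> is the cost of one step, and
  the steps that the optimal strategy takes have a fixed length.
\<close>
definition G :: "real \<Rightarrow> real" where "G x = integral {0..x} g"

lemma g_mono: "x \<le> y \<Longrightarrow> g x \<le> g y"
  using mono_g by (simp add: mono_def)

lemma filterlim_scale: "0 < t \<Longrightarrow> filterlim (\<lambda>x::real. t * x) at_top at_top"
  by real_asymp

text \<open>
  A bounded \<open>g\<close> would come arbitrarily close to its supremum, and one more doubling of the argument,
  which multiplies \<open>g\<close> by almost \<open>2 powr \<rho> > 1\<close>, would exceed it.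
\<close>
lemma g_at_top: "filterlim g at_top at_top"
proof -
  have "1 < 2 powr \<rho>" using index_pos by simp
  then obtain k where k: "1 < k" "k < 2 powr \<rho>" using dense by blast
  have dbl: "eventually (\<lambda>x. k * g x < g (2 * x)) at_top"
    using order_tendstoD(1)[OF regvar[of 2] k(2), OF zero_less_numeral] g_pos
    by eventually_elim (simp add: field_simps)
  have unbounded: "\<exists>x. Z < g x" for Z
  proof (rule ccontr)
    assume "\<not> (\<exists>x. Z < g x)"
    then have le: "g x \<le> Z" for x by (auto simp: not_less)
    define S where "S = Sup (range g)"
    have bdd: "bdd_above (range g)" using le unfolding bdd_above_def by auto
    have up: "g x \<le> S" for x unfolding S_def using bdd by (auto intro: cSup_upper)
    from eventually_happens[OF g_pos] obtain x0 where "0 < g x0" by auto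
    with up[of x0] have S: "0 < S" by simp
    have "S / k < S" using S k by (simp add: field_simps)
    then obtain x1 where x1: "S / k < g x1" 
      unfolding S_def using less_cSup_iff[OF _ bdd, of "Sup (range g) / k"] by auto
    obtain x2 where "x1 \<le> x2" "k * g x2 < g (2 * x2)"
      using eventually_conj[OF dbl eventually_ge_at_top[of x1]]
      by (auto dest: eventually_happens)
    moreover have "S < k * g x2"
      using x1 k g_mono[OF \<open>x1 \<le> x2\<close>] by (simp add: field_simps) (smt (verit) mult_left_mono)
    ultimately show False using up[of "2 * x2"] by simp
  qed
  show ?thesis
    unfolding filterlim_at_top_gt[where c = 0]
  proof (intro allI impI)
    fix Z :: real
    obtain x where "Z < g x" using unbounded by blast
    then have "Z \<le> g y" if "x \<le> y" for y using g_mono[OF that] by simp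
    then show "eventually (\<lambda>x. Z \<le> g x) at_top"
      by (auto simp: eventually_at_top_linorder)
  qed
qed

lemma g_integrable: "g integrable_on {a..b}"
  by (rule integrable_on_mono_on) (auto simp: mono_on_def g_mono)

lemma G_diff: assumes "0 \<le> a" "a \<le> b"
  shows "(b - a) * g a \<le> G b - G a" "G b - G a \<le> (b - a) * g b"
proof -
  have eq: "G b - G a = integral {a..b} g"
    unfolding G_def
    using Henstock_Kurzweil_Integration.integral_combine[OF assms(1,2) g_integrable] by simp
  have "integral {a..b} (\<lambda>_. g a) \<le> integral {a..b} g"
    by (rule integral_le) (auto simp: g_integrable g_mono)
  then show "(b - a) * g a \<le> G b - G a" using assms eq by simp
  have "integral {a..b} g \<le> integral {a..b} (\<lambda>_. g b)"
    by (rule integral_le) (auto simp: g_integrable g_mono)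
  then show "G b - G a \<le> (b - a) * g b" using assms eq by simp
qed

lemma G_neg: "x \<le> 0 \<Longrightarrow> G x = 0"
  unfolding G_def by (cases "x = 0") auto

lemma G_nonneg: "0 \<le> G x"
  unfolding G_def by (intro integral_nonneg) (auto simp: g_integrable g_nonneg)

lemma G_mono: assumes "x \<le> y" shows "G x \<le> G y"
proof (cases "0 \<le> x")
  case True
  have "0 \<le> (y - x) * g x" using assms g_nonneg by simp
  with G_diff(1)[OF True assms] show ?thesis by simp
qed (simp add: G_neg G_nonneg)

text \<open>
  Karamata's theorem. For monotone \<open>g\<close> it needs no uniform convergence theorem: after
  rescaling, \<open>G x / (x * g x)\<close> is the integral of \<open>g (x * t) / g x\<close> over \<open>t \<in> {0..1}\<close>, which
  monotonicity bounds by 1, and dominated convergence gives the integral of \<open>t powr \<rho>\<close>.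
\<close>
lemma karamata_primitive: "((\<lambda>x. G x / (x * g x)) \<longlongrightarrow> 1 / (\<rho> + 1)) at_top"
proof -
  define s where "s x t = indicator {0..1} t * (g (x * t) / g x)" for x t :: real
  have meas[measurable]: "g \<in> borel_measurable borel"
    using mono_g by (rule borel_measurable_mono)
  have "((\<lambda>x. integral\<^sup>L lborel (s x)) \<longlongrightarrow>
      integral\<^sup>L lborel (\<lambda>t. indicator {0..1} t * t powr \<rho>)) at_top"
  proof (rule integral_dominated_convergence_at_top)
    show "s x \<in> borel_measurable lborel" for x unfolding s_def by measurable
    show "integrable lborel (indicator {0..1::real} :: real \<Rightarrow> real)" by simp
    show "(\<lambda>t. indicator {0..1} t * t powr \<rho>) \<in> borel_measurable lborel" by measurable
    have "eventually (\<lambda>x. 0 < g x \<and> 0 < x) at_top"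
      using g_pos eventually_gt_at_top[of 0] by eventually_elim auto
    then show "\<forall>\<^sub>F x in at_top. AE t in lborel. norm (s x t) \<le> indicator {0..1} t"
    proof eventually_elim
      case (elim x)
      have "norm (s x t) \<le> indicator {0..1} t" for t
        using elim g_mono[of "x * t" x] g_nonneg[of "x * t"]
        by (auto simp: s_def indicator_def mult_left_le)
      then show ?case by simp
    qed
    have "((\<lambda>x. s x t) \<longlongrightarrow> indicator {0..1} t * t powr \<rho>) at_top" if "t \<noteq> 0" for t
      unfolding s_def using that regvar[of t]
      by (cases "t \<in> {0..1}") (auto intro!: tendsto_intros simp: mult.commute)
    with AE_lborel_singleton[of 0]
    show "AE t in lborel. ((\<lambda>x. s x t) \<longlongrightarrow> indicator {0..1} t * t powr \<rho>) at_top"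
      by (auto elim!: AE_mp)
  qed
  moreover have "integral\<^sup>L lborel (\<lambda>t. indicator {0..1} t * t powr \<rho>) = 1 / (\<rho> + 1)"
  proof -
    have "set_integrable lborel {0..1} (\<lambda>t. t powr \<rho>)"
      unfolding set_integrable_def
      by (rule integrableI_bounded_set[where A = "{0..1}" and B = 1])
         (use index_pos in \<open>auto simp: powr_le1\<close>)
    from set_borel_integral_eq_integral(2)[OF this]
    have "integral\<^sup>L lborel (\<lambda>t. indicator {0..1} t * t powr \<rho>) = integral {0..1} (\<lambda>t. t powr \<rho>)"
      by (simp add: set_lebesgue_integral_def)
    also have "\<dots> = 1 / (\<rho> + 1)"
      using has_integral_powr_from_0[of \<rho> 1] index_pos by (simp add: integral_unique)
    finally show ?thesis .
  qed
  moreover have "eventually (\<lambda>x. integral\<^sup>L lborel (s x) = G x / (x * g x)) at_top"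
    using g_pos eventually_gt_at_top[of 0]
  proof eventually_elim
    case (elim x)
    have "set_integrable lborel {0..1} (\<lambda>t. g (x * t))"
      unfolding set_integrable_def
      by (rule integrableI_bounded_set[where A = "{0..1}" and B = "g x"])
         (use elim g_nonneg in \<open>auto simp: mult_left_le g_mono\<close>)
    from set_borel_integral_eq_integral(2)[OF this]
    have "integral\<^sup>L lborel (\<lambda>t. indicator {0..1} t * g (x * t)) = integral {0..1} (\<lambda>t. g (x * t))"
      by (simp add: set_lebesgue_integral_def)
    also have "\<dots> = G x / x"
    proof -
      have "(\<lambda>t. t / x) ` {0..x} = {0..1}"
        using elim by (simp add: image_divide_atLeastAtMost)
      then show ?thesis
        using integral_stretch_real[of x 0 x g] elim by (simp add: G_def)
    qed
    finally have *: "integral\<^sup>L lborel (\<lambda>t. indicator {0..1} t * g (x * t)) = G x / x" .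
    have "integral\<^sup>L lborel (s x) = integral\<^sup>L lborel (\<lambda>t. indicator {0..1} t * g (x * t)) / g x"
    proof -
      have "s x = (\<lambda>t. indicator {0..1} t * g (x * t) / g x)" by (simp add: s_def fun_eq_iff)
      then show ?thesis by simp
    qed
    with * show ?case using elim by simp
  qed
  ultimately show ?thesis by (auto intro: Lim_transform_eventually)
qed

text \<open>
  An increment of at most \<open>g (\<kappa> * z) + C\<close> per step of length \<open>s\<close> makes \<open>h\<close> grow no faster than the
  Riemann sums of \<open>z \<mapsto> g (\<kappa> * z) + C\<close> with mesh \<open>s\<close>. Evaluating \<open>g\<close> at the left end of each
  step makes these lower sums, so the integral bounds them exactly, without an error term. The
  additive constant covers the first step.
\<close>
lemma recursion_bound:
  fixes h :: "real \<Rightarrow> real"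
  assumes "0 < s" "0 < \<kappa>" "0 \<le> C" "0 \<le> z0" "mono h"
    and step: "\<And>z. z0 \<le> z \<Longrightarrow> h (z + s) \<le> h z + g (\<kappa> * z) + C"
    and "z0 \<le> x"
  shows "h x \<le> G (\<kappa> * x) / (\<kappa> * s) + C / s * (x - z0) + h (z0 + s)"
proof -
  have "h x \<le> G (\<kappa> * x) / (\<kappa> * s) + C / s * (x - z0) + h (z0 + s)"
    if "z0 \<le> x" "x \<le> z0 + real n * s" for n x
    using that
  proof (induction n arbitrary: x)
    case (Suc n)
    show ?case
    proof (cases "x \<le> z0 + s")
      case True
      then have "h x \<le> h (z0 + s)" using \<open>mono h\<close> by (simp add: mono_def)
      moreover have "0 \<le> G (\<kappa> * x) / (\<kappa> * s)" using assms G_nonneg by simp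
      moreover have "0 \<le> C / s * (x - z0)" using assms Suc.prems by simp
      ultimately show ?thesis by linarith
    next
      case False
      define y where "y = x - s"
      have y: "z0 \<le> y" "y \<le> z0 + real n * s" "x = y + s"
        using False Suc.prems by (auto simp: y_def algebra_simps)
      have "(\<kappa> * x - \<kappa> * y) * g (\<kappa> * y) \<le> G (\<kappa> * x) - G (\<kappa> * y)"
        using y assms by (intro G_diff(1)) auto
      then have "\<kappa> * s * g (\<kappa> * y) \<le> G (\<kappa> * x) - G (\<kappa> * y)"
        using y by (simp add: algebra_simps)
      then have "g (\<kappa> * y) \<le> (G (\<kappa> * x) - G (\<kappa> * y)) / (\<kappa> * s)"
        using assms by (simp add: pos_le_divide_eq mult.commute)
      moreover have "C = C / s * (x - z0) - C / s * (y - z0)"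
        using y assms by (simp add: field_simps)
      ultimately show ?thesis
        using step[OF y(1)] Suc.IH[OF y(1,2)] y(3) by (simp add: diff_divide_distrib)
    qed
  next
    case 0
    then have "h x \<le> h (z0 + s)" using \<open>mono h\<close> assms by (simp add: mono_def)
    moreover have "0 \<le> G (\<kappa> * x) / (\<kappa> * s)" using assms G_nonneg by simp
    ultimately show ?case using 0 by simp
  qed
  moreover obtain n where "(x - z0) / s \<le> real n" using real_arch_simple by blast
  then have "x \<le> z0 + real n * s" using assms by (simp add: field_simps)
  ultimately show ?thesis using \<open>z0 \<le> x\<close> by blast
qed

lemma G_scale:
  assumes "0 < t"
  shows "((\<lambda>x. G (t * x) / (x * g x)) \<longlongrightarrow> t powr (\<rho> + 1) / (\<rho> + 1)) at_top"
proof -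
  have "((\<lambda>x. G (t * x) / (t * x * g (t * x)) * (t * (g (t * x) / g x))) \<longlongrightarrow>
      1 / (\<rho> + 1) * (t * t powr \<rho>)) at_top"
    by (intro tendsto_intros regvar assms filterlim_compose[OF karamata_primitive filterlim_scale])
  moreover have "eventually (\<lambda>x. G (t * x) / (t * x * g (t * x)) * (t * (g (t * x) / g x))
      = G (t * x) / (x * g x)) at_top"
  proof -
    have "eventually (\<lambda>x. 0 < g (t * x)) at_top"
      using filterlim_scale[OF assms] g_pos by (rule eventually_compose_filterlim[rotated])
    with g_pos show ?thesis by eventually_elim (use assms in \<open>auto simp: field_simps\<close>)
  qed
  ultimately show ?thesis
    using assms by (auto intro: Lim_transform_eventually simp: powr_add mult.commute)
qed

text \<open>
  The price of keeping \<open>Q\<close> near its supremum grows linearly, hence does not affect the asymptotics.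
\<close>
lemma affine_negligible: "((\<lambda>x. (a * x + b) / (x * g x)) \<longlongrightarrow> 0) at_top"
proof -
  have "((\<lambda>x. (a + b / x) * inverse (g x)) \<longlongrightarrow> (a + 0) * 0) at_top"
    by (intro tendsto_intros tendsto_inverse_0_at_top g_at_top) real_asymp
  moreover have "eventually (\<lambda>x. (a + b / x) * inverse (g x) = (a * x + b) / (x * g x)) at_top"
    using eventually_gt_at_top[of 0] by eventually_elim (auto simp: field_simps)
  ultimately show ?thesis by (auto intro: Lim_transform_eventually)
qed

end

section \<open>Lower bounds for the tail of a perpetuity\<close>

text \<open>
  The hypotheses of the theorem in terms of \<open>g\<close>. That \<open>M < 1\<close> almost surely follows from
  regular variation with positive index, as \<open>g\<close> then tends to infinity.
\<close>
locale perpetuity_tail = increasing_regvar g \<rho>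
  for g :: "real \<Rightarrow> real" and \<rho> :: real +
  fixes P :: "'a measure" and M Q :: "'a \<Rightarrow> real"
    and N :: "'b measure" and R :: "'b \<Rightarrow> real" and q :: real
  assumes perp: "is_perpetuity P M Q N R"
    and indep: "prob_space.indep_var P borel M borel Q"
    and M_range: "AE \<omega> in P. 0 \<le> M \<omega> \<and> M \<omega> < 1"
    and M_tail: "0 < x \<Longrightarrow> \<P>(\<omega> in P. 1 - 1 / x < M \<omega>) = exp (- g x)"
    and Q_le: "AE \<omega> in P. Q \<omega> \<le> q"
    and Q_tail: "b < q \<Longrightarrow> 0 < \<P>(\<omega> in P. b < Q \<omega>)"
    and q_pos: "0 < q"
begin

sublocale P: prob_space P using perp by (simp add: is_perpetuity_def)
sublocale N: prob_space N using perp by (simp add: is_perpetuity_def)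
sublocale PN: pair_prob_space P N ..

lemma measurable_MQR [measurable]:
  "M \<in> borel_measurable P" "Q \<in> borel_measurable P" "R \<in> borel_measurable N"
  using perp by (simp_all add: is_perpetuity_def)

lemma distr_R: "distr N borel R = distr (P \<Otimes>\<^sub>M N) borel (\<lambda>(\<omega>, \<omega>'). M \<omega> * R \<omega>' + Q \<omega>)"
  using perp by (simp add: is_perpetuity_def)

lemma nn_integral_fixed_point:
  fixes f :: "real \<Rightarrow> ennreal"
  assumes [measurable]: "f \<in> borel_measurable borel"
  shows "(\<integral>\<^sup>+\<omega>'. f (R \<omega>') \<partial>N) = (\<integral>\<^sup>+\<omega>'. (\<integral>\<^sup>+\<omega>. f (M \<omega> * R \<omega>' + Q \<omega>) \<partial>P) \<partial>N)"
proof -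
  have "(\<integral>\<^sup>+\<omega>'. f (R \<omega>') \<partial>N) = (\<integral>\<^sup>+x. f x \<partial>distr N borel R)"
    by (simp add: nn_integral_distr)
  also have "\<dots> = (\<integral>\<^sup>+p. f (case p of (\<omega>, \<omega>') \<Rightarrow> M \<omega> * R \<omega>' + Q \<omega>) \<partial>(P \<Otimes>\<^sub>M N))"
    unfolding distr_R by (subst nn_integral_distr) simp_all
  also have "\<dots> = (\<integral>\<^sup>+\<omega>'. (\<integral>\<^sup>+\<omega>. f (M \<omega> * R \<omega>' + Q \<omega>) \<partial>P) \<partial>N)"
    by (subst PN.nn_integral_snd[symmetric]) simp_all
  finally show ?thesis .
qed

definition tail :: "real \<Rightarrow> real" where "tail x = \<P>(\<omega> in N. x < R \<omega>)"

lemma tail_antimono: "x \<le> y \<Longrightarrow> tail y \<le> tail x"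
  unfolding tail_def by (intro N.finite_measure_mono) auto

text \<open>
  \<open>E\<close> is an event for the first coordinate of the product space. Since \<open>R\<close> lives on the second one,
  the probability that \<open>(M, Q)\<close> is favourable and \<open>R\<close> is already above \<open>z\<close> factorizes.
\<close>
lemma tail_step:
  assumes [measurable]: "E \<in> sets P"
    and E: "\<And>\<omega> \<omega>'. \<omega> \<in> E \<Longrightarrow> z < R \<omega>' \<Longrightarrow> z' < M \<omega> * R \<omega>' + Q \<omega>"
  shows "P.prob E * tail z \<le> tail z'"
proof -
  let ?A = "{\<omega> \<in> space N. z < R \<omega>}"
  have "emeasure (P \<Otimes>\<^sub>M N) (E \<times> ?A) = emeasure P E * emeasure N ?A"
    by (rule N.emeasure_pair_measure_Times) auto
  then have "P.prob E * tail z = PN.prob (E \<times> ?A)"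
    by (simp add: tail_def measure_def enn2real_mult)
  also have "\<dots> \<le> PN.prob {p \<in> space (P \<Otimes>\<^sub>M N). z' < (case p of (\<omega>, \<omega>') \<Rightarrow> M \<omega> * R \<omega>' + Q \<omega>)}"
    using sets.sets_into_space[OF assms(1)]
    by (intro PN.finite_measure_mono) (auto simp: space_pair_measure E)
  also have "\<dots> = measure (distr (P \<Otimes>\<^sub>M N) borel (\<lambda>(\<omega>, \<omega>'). M \<omega> * R \<omega>' + Q \<omega>)) {z'<..}"
    by (subst measure_distr) (auto simp: vimage_def intro!: arg_cong[where f = PN.prob])
  also have "\<dots> = measure (distr N borel R) {z'<..}"
    by (simp add: distr_R)
  also have "\<dots> = tail z'"
    by (subst measure_distr) (auto simp: vimage_def tail_def intro!: arg_cong[where f = N.prob])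
  finally show ?thesis .
qed

lemma prob_restrict_M_range:
  assumes [measurable]: "Measurable.pred P A"
  shows "\<P>(\<omega> in P. 0 \<le> M \<omega> \<and> M \<omega> < 1 \<and> A \<omega>) = \<P>(\<omega> in P. A \<omega>)"
  using M_range by (intro P.finite_measure_eq_AE) auto

text \<open>
  One step of the optimal strategy. For \<open>R > z\<close> and \<open>M > 1 - 1/y\<close> with \<open>y = u / b * z\<close>, the loss
  \<open>(1 - M) * z\<close> is less than \<open>z / y = b / u\<close>, so that the net gain exceeds \<open>b - b / u\<close>, uniformly in \<open>z\<close>.
\<close>
lemma tail_climb:
  assumes "0 < b" "b < q" "1 < u" "0 < z"
  shows "exp (- g (u / b * z)) * \<P>(\<omega> in P. b < Q \<omega>) * tail z \<le> tail (z + b * (1 - 1 / u))"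
proof -
  define y where "y = u / b * z"
  have "0 < y" using assms by (simp add: y_def)
  let ?E = "{\<omega> \<in> space P. 0 \<le> M \<omega> \<and> M \<omega> < 1 \<and> (1 - 1 / y < M \<omega> \<and> b < Q \<omega>)}"
  have "P.prob ?E = \<P>(\<omega> in P. 1 - 1 / y < M \<omega> \<and> b < Q \<omega>)"
    by (rule prob_restrict_M_range) measurable
  also have "\<dots> = \<P>(\<omega> in P. 1 - 1 / y < M \<omega>) * \<P>(\<omega> in P. b < Q \<omega>)"
    using P.indep_varD[OF indep, of "{1 - 1 / y<..}" "{b<..}"]
    by (simp add: vimage_def Int_def conj_commute)
  finally have E: "P.prob ?E = exp (- g y) * \<P>(\<omega> in P. b < Q \<omega>)"
    using M_tail[OF \<open>0 < y\<close>] by simp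
  have "P.prob ?E * tail z \<le> tail (z + b * (1 - 1 / u))"
  proof (rule tail_step)
    fix \<omega> \<omega>' assume \<omega>: "\<omega> \<in> ?E" "z < R \<omega>'"
    have "z - b / u = (1 - 1 / y) * z"
      using assms by (simp add: y_def field_simps)
    also have "\<dots> < M \<omega> * z" using \<omega> assms by simp
    also have "\<dots> \<le> M \<omega> * R \<omega>'" using \<omega> by (intro mult_left_mono) auto
    finally show "z + b * (1 - 1 / u) < M \<omega> * R \<omega>' + Q \<omega>"
      using \<omega> by (simp add: algebra_simps)
  qed simp
  then show ?thesis unfolding E unfolding y_def .
qed

text \<open>
  Some level, possibly negative, is exceeded with positive probability. Below 0, multiplication
  by \<open>M \<in> [0, 1)\<close> cannot decrease the level, so that adding \<open>Q\<close> alone leads to a positive level; from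
  there \<open>tail_climb\<close> reaches every level.
\<close>
lemma tail_pos: "0 < tail x"
proof -
  have "\<exists>n. 0 < tail (- real n)"
  proof (rule ccontr)
    assume "\<not> (\<exists>n. 0 < tail (- real n))"
    then have "tail (- real n) = 0" for n
      by (metis less_eq_real_def measure_nonneg tail_def)
    then have "AE \<omega> in N. \<not> (- real n < R \<omega>)" for n
      using N.prob_eq_0[of "{\<omega> \<in> space N. - real n < R \<omega>}"] by (simp add: tail_def)
    then have "AE \<omega> in N. \<forall>n. \<not> (- real n < R \<omega>)" by (simp add: AE_all_countable)
    then have "AE \<omega> in N. False"
    proof eventually_elim
      case (elim \<omega>)
      obtain n where "- R \<omega> < real n" using reals_Archimedean2 by blast
      with elim show ?case by (metis minus_less_iff)
    qed
    then show False by simp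
  qed
  then obtain n0 where n0: "0 < tail (- real n0)" by blast
  have step: "0 < tail (z + q / 2)" if "0 < tail z" "z \<le> 0" for z
  proof -
    let ?E = "{\<omega> \<in> space P. 0 \<le> M \<omega> \<and> M \<omega> < 1 \<and> q / 2 < Q \<omega>}"
    have "P.prob ?E = \<P>(\<omega> in P. q / 2 < Q \<omega>)" by (rule prob_restrict_M_range) measurable
    then have "0 < P.prob ?E * tail z" using Q_tail[of "q / 2"] q_pos that by simp
    also have "\<dots> \<le> tail (z + q / 2)"
    proof (rule tail_step)
      fix \<omega> \<omega>' assume \<omega>: "\<omega> \<in> ?E" "z < R \<omega>'"
      have "z \<le> M \<omega> * z" using \<omega> that mult_right_mono_neg[of "M \<omega>" 1 z] by simp
      also have "\<dots> \<le> M \<omega> * R \<omega>'" using \<omega> by (intro mult_left_mono) auto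
      finally show "z + q / 2 < M \<omega> * R \<omega>' + Q \<omega>" using \<omega> by simp
    qed simp
    finally show ?thesis .
  qed
  have "(\<exists>z>0. 0 < tail z) \<or> 0 < tail (- real n0 + real k * (q / 2))" for k
  proof (induction k)
    case (Suc k)
    define w where "w = - real n0 + real k * (q / 2)"
    have eq: "- real n0 + real (Suc k) * (q / 2) = w + q / 2" by (simp add: w_def field_simps)
    from Suc have "(\<exists>z>0. 0 < tail z) \<or> 0 < tail w" unfolding w_def .
    with step[of w] show ?case unfolding eq by (cases "w \<le> 0") (auto simp: not_le)
  qed (use n0 in simp)
  moreover obtain k where "real n0 < real k * (q / 2)"
    using reals_Archimedean3[of "q / 2"] q_pos by auto
  ultimately obtain z0 where z0: "0 < z0" "0 < tail z0"
    by (metis add.commute diff_gt_0_iff_gt uminus_add_conv_diff)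
  \<comment> \<open>the gain \<open>b * (1 - 1 / u)\<close> of \<open>tail_climb\<close> for \<open>b = q / 2\<close> and \<open>u = 2\<close>\<close>
  define s where "s = q / 4"
  have climb: "0 < tail (z + s)" if "0 < tail z" "0 < z" for z
  proof -
    have "0 < exp (- g (2 / (q / 2) * z)) * \<P>(\<omega> in P. q / 2 < Q \<omega>) * tail z"
      using that Q_tail[of "q / 2"] q_pos by simp
    also have "\<dots> \<le> tail (z + s)"
      using tail_climb[of "q / 2" 2 z] that q_pos by (simp add: s_def)
    finally show ?thesis .
  qed
  have "0 < tail (z0 + real k * s)" for k
  proof (induction k)
    case (Suc k)
    have "z0 + real (Suc k) * s = z0 + real k * s + s" by (simp add: algebra_simps)
    moreover have "0 < tail (z0 + real k * s + s)"
      using climb[OF Suc] z0 q_pos by (simp add: s_def add_pos_nonneg)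
    ultimately show ?case by (simp only:)
  qed (use z0 in simp)
  moreover have "0 < s" using q_pos by (simp add: s_def)
  then obtain k where "x - z0 < real k * s" using reals_Archimedean3[of s] by blast
  ultimately show ?thesis
    using tail_antimono[of x "z0 + real k * s"] by (smt (verit))
qed

definition tail_exponent :: "real \<Rightarrow> real" where "tail_exponent x = - ln (tail x)"

lemma mono_tail_exponent: "mono tail_exponent"
  unfolding mono_def tail_exponent_def using tail_antimono tail_pos by simp

lemma tail_exponent_upper:
  assumes "0 < b" "b < q" "1 < u"
  obtains A D where "\<And>x. 1 \<le> x \<Longrightarrow> tail_exponent x \<le> G (u / b * x) / (u - 1) + A * x + D"
proof -
  define s \<kappa> C where "s = b * (1 - 1 / u)" and "\<kappa> = u / b"
    and "C = - ln (\<P>(\<omega> in P. b < Q \<omega>))"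
  have pos: "0 < s" "0 < \<kappa>" "0 < \<P>(\<omega> in P. b < Q \<omega>)"
    using assms Q_tail by (auto simp: s_def \<kappa>_def)
  have "0 \<le> C" using pos by (simp add: C_def)
  have "tail_exponent (z + s) \<le> tail_exponent z + g (\<kappa> * z) + C" if "1 \<le> z" for z
  proof -
    have "ln (exp (- g (\<kappa> * z)) * \<P>(\<omega> in P. b < Q \<omega>) * tail z) \<le> ln (tail (z + s))"
      using tail_climb[OF assms, of z] that pos tail_pos by (subst ln_le_cancel_iff) (auto simp: s_def \<kappa>_def)
    then show ?thesis
      using pos tail_pos[of z] by (simp add: tail_exponent_def C_def ln_mult)
  qed
  from recursion_bound[OF pos(1,2) \<open>0 \<le> C\<close> zero_le_one mono_tail_exponent this]
  have bound: "tail_exponent x \<le> G (\<kappa> * x) / (\<kappa> * s) + C / s * (x - 1) + tail_exponent (1 + s)" if "1 \<le> x" for x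
    using that by simp
  have "\<kappa> * s = u - 1" using assms by (simp add: s_def \<kappa>_def field_simps)
  then have "tail_exponent x \<le> G (u / b * x) / (u - 1) + C / s * x + (tail_exponent (1 + s) - C / s)" if "1 \<le> x" for x
    using bound[OF that] by (simp only: \<kappa>_def) (simp add: right_diff_distrib)
  then show thesis by (rule that)
qed

end

section \<open>The best constant and the growth in one step\<close>

context increasing_regvar
begin

text \<open>
  The minimum of \<open>u powr (\<rho> + 1) / (u - 1)\<close> over \<open>u > 1\<close>, attained at \<open>u = (\<rho> + 1) / \<rho>\<close>.
\<close>
definition optimal_rate :: real where
  "optimal_rate = (\<rho> + 1) powr (\<rho> + 1) / \<rho> powr \<rho>"

lemma optimal_rate_pos: "0 < optimal_rate"
  using index_pos by (simp add: optimal_rate_def)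

text \<open>
  The minimality of \<open>optimal_rate\<close> in terms of \<open>v = 1 / u\<close>. It is the weighted inequality of
  arithmetic and geometric means: \<open>v * (\<rho> + 1) / \<rho>\<close> with weight \<open>\<rho>\<close> and \<open>(1 - v) * (\<rho> + 1)\<close> with
  weight 1 have mean 1, hence \<open>ln t \<le> t - 1\<close> bounds the weighted sum of their logarithms by 0.
\<close>
lemma optimal_rate_bound:
  assumes "0 < v" "v \<le> 1"
  shows "optimal_rate * (1 - v) \<le> v powr - \<rho>"
proof (cases "v = 1")
  case False
  with assms have v: "0 < v" "v < 1" by auto
  define y where "y = v * (\<rho> + 1) / \<rho>"
  define y' where "y' = (1 - v) * (\<rho> + 1)"
  have pos: "0 < y" "0 < y'" using v index_pos by (auto simp: y_def y'_def)
  have "\<rho> * ln y + ln y' \<le> \<rho> * (y - 1) + (y' - 1)"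
    using index_pos ln_le_minus_one pos by (intro add_mono mult_left_mono) auto
  also have "\<dots> = 0" using index_pos by (simp add: y_def y'_def field_simps)
  finally have le: "\<rho> * ln y + ln y' \<le> 0" .
  have "ln (optimal_rate * (1 - v)) = \<rho> * ln y + ln y' + - \<rho> * ln v"
  proof -
    have 1: "ln y = ln v + ln (\<rho> + 1) - ln \<rho>" "ln y' = ln (1 - v) + ln (\<rho> + 1)"
      using v index_pos by (simp_all add: y_def y'_def ln_mult ln_div)
    have 2: "ln (optimal_rate * (1 - v)) = ln optimal_rate + ln (1 - v)"
      using v optimal_rate_pos by (simp add: ln_mult)
    have 3: "ln optimal_rate = (\<rho> + 1) * ln (\<rho> + 1) - \<rho> * ln \<rho>"
      using index_pos by (simp add: optimal_rate_def ln_div ln_powr)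
    show ?thesis unfolding 1 2 3 by (simp add: algebra_simps)
  qed
  also have "\<dots> \<le> ln (v powr - \<rho>)" using le v by (simp add: ln_powr)
  finally show ?thesis
    using v optimal_rate_pos by (subst (asm) ln_le_cancel_iff) auto
qed simp

text \<open>
  A bound for the mean of \<open>exp (B * (G (M * w + 1) - G w))\<close>, obtained by sorting the loss
  \<open>v = (1 - M) * w\<close> into \<open>n\<close> cells of length \<open>1 / n\<close> in \<open>[0, 1)\<close>, where the chain climbs, the interval
  \<open>[1, 2)\<close>, and the rest, where it falls by at least 1. The loss is below \<open>\<tau>\<close> with probability
  \<open>exp (- g (w / \<tau>))\<close>.
\<close>
definition growth_bound :: "real \<Rightarrow> nat \<Rightarrow> real \<Rightarrow> real" where
  "growth_bound B n w = (\<Sum>k<n. exp (B * (1 - k / n) * g (w + 1) - g (w / (real (k + 1) / real n))))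
     + exp (- g (w / 2)) + exp (- B * g (w - 1))"

text \<open>
  The bound behind \<open>growth_bound\<close> for a given loss \<open>v\<close>, with \<open>w + 1 - v\<close> the new level. Each cell of losses is
  enlarged to all losses below its upper end, whose probabilities are known exactly.
\<close>
lemma exp_increment_bound:
  fixes n :: nat
  assumes "0 < B" "2 \<le> w" "0 < v" "v \<le> w" "0 < n"
  shows "exp (B * (G (w + 1 - v) - G w)) \<le>
    (\<Sum>k<n. exp (B * (1 - k / n) * g (w + 1)) * of_bool (v < real (k + 1) / real n))
     + of_bool (v < 2) + exp (- B * g (w - 1))"
proof -
  let ?S = "\<Sum>k<n. exp (B * (1 - real k / real n) * g (w + 1)) * of_bool (v < real (k + 1) / real n)"
  have S: "0 \<le> ?S" by (intro sum_nonneg) auto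
  consider "v < 1" | "1 \<le> v" "v < 2" | "2 \<le> v" by linarith
  then show ?thesis
  proof cases
    case 1
    define k where "k = nat \<lfloor>v * n\<rfloor>"
    have "0 \<le> v * n" using assms by simp
    then have k: "real k \<le> v * n" "v * n < real k + 1" by (auto simp: k_def)
    have "v * n < n" using 1 assms by simp
    with k have "k < n" by linarith
    have v: "k / n \<le> v" "v < (k + 1) / n" using k assms by (auto simp: field_simps)
    have "G (w + 1 - v) - G w \<le> (w + 1 - v - w) * g (w + 1 - v)"
      using assms 1 by (intro G_diff(2)) auto
    also have "\<dots> \<le> (1 - k / n) * g (w + 1)"
      using v 1 assms \<open>k < n\<close> by (intro mult_mono g_mono g_nonneg) auto
    finally have "exp (B * (G (w + 1 - v) - G w)) \<le> exp (B * (1 - k / n) * g (w + 1))"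
      using assms by (simp add: mult.assoc)
    also have "\<dots> = exp (B * (1 - k / n) * g (w + 1)) * of_bool (v < real (k + 1) / real n)"
      using v by simp
    also have "\<dots> \<le> ?S"
      using \<open>k < n\<close>
        member_le_sum[of k "{..<n}" "\<lambda>k. exp (B * (1 - real k / real n) * g (w + 1)) * of_bool (v < real (k + 1) / real n)"]
      by simp
    finally show ?thesis by (simp add: add_increasing2)
  next
    case 2
    have "G (w + 1 - v) \<le> G w" using 2 by (intro G_mono) auto
    then have "exp (B * (G (w + 1 - v) - G w)) \<le> 1"
      using assms by (simp add: mult_nonneg_nonpos)
    also have "\<dots> = of_bool (v < 2)" using 2 by simp
    finally show ?thesis using S by (smt (verit) exp_ge_zero)
  next
    case 3
    have "G (w + 1 - v) \<le> G (w - 1)" using 3 by (intro G_mono) auto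
    also have "\<dots> \<le> G w - g (w - 1)" using G_diff(1)[of "w - 1" w] assms by simp
    finally have "B * (G (w + 1 - v) - G w) \<le> B * (- g (w - 1))"
      using assms by (intro mult_left_mono) auto
    then have "exp (B * (G (w + 1 - v) - G w)) \<le> exp (- B * g (w - 1))" by simp
    then show ?thesis using S by (smt (verit) of_bool_def)
  qed
qed

text \<open>
  For a loss near \<open>v \<in> (0, 1]\<close> the exponent is about \<open>(B * (1 - v) - v powr - \<rho>) * g w\<close>, which is negative by
  \<open>optimal_rate_bound\<close>; it stays at most a negative multiple of \<open>g w\<close> uniformly in \<open>v\<close> because \<open>B\<close> is
  strictly below \<open>optimal_rate\<close>. A fine enough grid preserves this, and there are finitely many cells.
\<close>
lemma growth_bound_tendsto_0:
  assumes "0 < B" "B < optimal_rate"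
  obtains n where "0 < n" "((\<lambda>w. growth_bound B n w) \<longlongrightarrow> 0) at_top"
proof -
  \<comment> \<open>\<open>g (w + 1)\<close> will be compared with \<open>g (l * w)\<close>, whose ratio to \<open>g w\<close> has a known limit;
    the room between \<open>B\<close> and \<open>optimal_rate\<close> absorbs the factor \<open>l powr \<rho>\<close>.\<close>
  have "((\<lambda>l. B * l powr \<rho>) \<longlongrightarrow> B * 1 powr \<rho>) (at_right 1)"
    by (intro tendsto_intros) auto
  then have "eventually (\<lambda>l. B * l powr \<rho> < optimal_rate) (at_right 1)"
    using assms by (intro order_tendstoD) auto
  then have "eventually (\<lambda>l. B * l powr \<rho> < optimal_rate \<and> 1 < l) (at_right 1)"
    using eventually_at_right_less by (rule eventually_conj)
  then obtain l where l: "B * l powr \<rho> < optimal_rate" "1 < l"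
    using eventually_happens[of _ "at_right (1::real)"] by auto
  define B' where "B' = B * l powr \<rho>"
  have B': "0 < B'" "B' < optimal_rate" using l assms by (auto simp: B'_def)
  define \<theta> where "\<theta> = B' / optimal_rate"
  have \<theta>: "\<theta> < 1" "B' = \<theta> * optimal_rate" "0 < \<theta>" using B' by (auto simp: \<theta>_def)
  obtain n :: nat where n: "B' / (1 - \<theta>) < n" using reals_Archimedean2 by blast
  then have n0: "0 < n" using B' \<theta> by (smt (verit) divide_pos_pos of_nat_0_less_iff)
  have n': "B' / n < 1 - \<theta>" using n n0 \<theta> by (simp add: field_simps)
  have "((\<lambda>w. exp (B * (1 - k / n) * g (w + 1) - g (w / (real (k + 1) / real n)))) \<longlongrightarrow> 0) at_top"
    if "k < n" for k
  proof -
    define v where "v = real (k + 1) / real n"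
    have v: "0 < v" "v \<le> 1" "1 - k / n = 1 - v + 1 / n" using that by (auto simp: v_def field_simps)
    have ge1: "1 \<le> v powr - \<rho>"
      using v index_pos by (simp add: powr_minus one_le_inverse_iff powr_le1)
    have "B' * (1 - k / n) = \<theta> * (optimal_rate * (1 - v)) + B' / n"
      using v \<theta> by (simp add: algebra_simps)
    also have "\<dots> < \<theta> * v powr - \<rho> + (1 - \<theta>)"
      using optimal_rate_bound[OF v(1,2)] \<theta> n' by (intro add_le_less_mono mult_left_mono) auto
    also have "\<dots> \<le> \<theta> * v powr - \<rho> + (1 - \<theta>) * v powr - \<rho>"
      using mult_left_mono[OF ge1, of "1 - \<theta>"] \<theta> by simp
    finally have neg: "B' * (1 - k / n) < v powr - \<rho>" by (simp add: algebra_simps)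
    have lim: "((\<lambda>w. B * (1 - k / n) * (g (l * w) / g w) - g (1 / v * w) / g w) \<longlongrightarrow>
        B * (1 - k / n) * l powr \<rho> - (1 / v) powr \<rho>) at_top"
      using l v by (intro tendsto_intros regvar) auto
    have val: "B * (1 - k / n) * l powr \<rho> - (1 / v) powr \<rho> < 0"
      using neg v by (simp add: B'_def powr_minus powr_divide field_simps)
    then have "filterlim (\<lambda>w. (B * (1 - k / n) * (g (l * w) / g w) - g (1 / v * w) / g w) * g w) at_bot at_top"
      by (rule filterlim_tendsto_neg_mult_at_bot[OF lim _ g_at_top])
    then have lim0: "((\<lambda>w. exp ((B * (1 - k / n) * (g (l * w) / g w) - g (1 / v * w) / g w) * g w)) \<longlongrightarrow> 0) at_top"
      by (rule filterlim_compose[OF exp_at_bot])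
    have "\<forall>\<^sub>F w in at_top. norm (exp (B * (1 - k / n) * g (w + 1) - g (w / (real (k + 1) / real n))))
        \<le> exp ((B * (1 - k / n) * (g (l * w) / g w) - g (1 / v * w) / g w) * g w)"
      using g_pos eventually_ge_at_top[of "1 / (l - 1)"]
    proof eventually_elim
      case (elim w)
      have "w + 1 \<le> l * w" using elim l by (simp add: field_simps)
      then have "B * (1 - k / n) * g (w + 1) \<le> B * (1 - k / n) * g (l * w)"
        using assms that by (intro mult_left_mono g_mono) auto
      moreover have "(B * (1 - k / n) * (g (l * w) / g w) - g (1 / v * w) / g w) * g w
          = B * (1 - k / n) * g (l * w) - g (1 / v * w)"
        using elim by (simp add: left_diff_distrib)
      moreover have "w / (real (k + 1) / real n) = 1 / v * w" by (simp add: v_def)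
      ultimately show ?case by simp
    qed
    then show ?thesis by (rule Lim_null_comparison[OF _ lim0])
  qed
  moreover have "((\<lambda>w. exp (- g (w / 2))) \<longlongrightarrow> 0) at_top"
  proof -
    have "filterlim (\<lambda>w::real. w / 2) at_top at_top" by real_asymp
    from filterlim_compose[OF g_at_top this] show ?thesis
      by (intro filterlim_compose[OF exp_at_bot]) (simp add: filterlim_uminus_at_bot)
  qed
  moreover have "((\<lambda>w. exp (- B * g (w - 1))) \<longlongrightarrow> 0) at_top"
  proof -
    have "filterlim (\<lambda>w::real. w - 1) at_top at_top" by real_asymp
    from filterlim_tendsto_pos_mult_at_top[OF tendsto_const assms(1) filterlim_compose[OF g_at_top this]]
    show ?thesis
      by (intro filterlim_compose[OF exp_at_bot]) (simp add: filterlim_uminus_at_bot)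
  qed
  ultimately have "((\<lambda>w. growth_bound B n w) \<longlongrightarrow> (\<Sum>k<n. 0) + 0 + 0) at_top"
    unfolding growth_bound_def by (intro tendsto_add tendsto_sum) auto
  with n0 show thesis by (intro that) auto
qed

end

section \<open>Upper bounds for the tail of a perpetuity\<close>

text \<open>
  If \<open>X\<close> were known to be integrable, letting \<open>K\<close> tend to infinity in a bound \<open>E X \<le> C + E X / 2\<close>
  would suffice. The truncated version loses a factor 2 in the truncation level at each iteration, so
  that \<open>n\<close> iterations leave the error \<open>E (min X (2 ^ n * K)) / 2 ^ n\<close>. This tends to 0 by dominated
  convergence, since \<open>X\<close> is finite.
\<close>
lemma (in prob_space) truncated_mean_bound:
  fixes X :: "'a \<Rightarrow> real"
  assumes [measurable]: "X \<in> borel_measurable M"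
    and nonneg: "\<And>\<omega>. 0 \<le> X \<omega>"
    and C: "0 \<le> C"
    and rec: "\<And>K. 0 < K \<Longrightarrow>
      expectation (\<lambda>\<omega>. min (X \<omega>) K) \<le> C + expectation (\<lambda>\<omega>. min (X \<omega>) (2 * K)) / 2"
    and K: "0 < K"
  shows "expectation (\<lambda>\<omega>. min (X \<omega>) K) \<le> 2 * C"
proof -
  define a where "a K = expectation (\<lambda>\<omega>. min (X \<omega>) K)" for K
  have iter: "a K \<le> 2 * C + a (2 ^ n * K) / 2 ^ n" for n
  proof -
    have "a K \<le> 2 * C * (1 - 1 / 2 ^ n) + a (2 ^ n * K) / 2 ^ n"
    proof (induction n)
      case (Suc n)
      have "a (2 ^ n * K) \<le> C + a (2 ^ Suc n * K) / 2"
        using rec[of "2 ^ n * K"] K by (simp add: a_def mult.assoc)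
      then have "a (2 ^ n * K) / 2 ^ n \<le> (C + a (2 ^ Suc n * K) / 2) / 2 ^ n"
        by (rule divide_right_mono) simp
      with Suc show ?case by (simp add: field_simps)
    qed simp
    moreover have "2 * C * (1 - 1 / 2 ^ n) \<le> 2 * C"
      using C by (intro mult_left_le) auto
    ultimately show ?thesis by linarith
  qed
  have "(\<lambda>n. expectation (\<lambda>\<omega>. min (X \<omega> / 2 ^ n) K)) \<longlonglongrightarrow> expectation (\<lambda>\<omega>. 0)"
  proof (rule integral_dominated_convergence[where w = "\<lambda>_. K"])
    show "AE \<omega> in M. (\<lambda>n. min (X \<omega> / 2 ^ n) K) \<longlonglongrightarrow> 0"
    proof (rule AE_I2)
      fix \<omega>
      have "(\<lambda>n. min (X \<omega> / 2 ^ n) K) \<longlonglongrightarrow> min 0 K"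
        by (intro tendsto_min tendsto_const) real_asymp
      then show "(\<lambda>n. min (X \<omega> / 2 ^ n) K) \<longlonglongrightarrow> 0" using K by simp
    qed
  qed (use nonneg K in \<open>auto simp: min_def\<close>)
  moreover have "expectation (\<lambda>\<omega>. min (X \<omega> / 2 ^ n) K) = a (2 ^ n * K) / 2 ^ n" for n
  proof -
    have "min (X \<omega> / 2 ^ n) K = min (X \<omega>) (2 ^ n * K) / 2 ^ n" for \<omega>
      by (simp add: min_def field_simps)
    then show ?thesis by (simp add: a_def)
  qed
  ultimately have "(\<lambda>n. 2 * C + a (2 ^ n * K) / 2 ^ n) \<longlonglongrightarrow> 2 * C + 0"
    by (intro tendsto_intros) simp
  with iter have "a K \<le> 2 * C"
    by (intro LIMSEQ_le_const[where a = "a K" and x = "2 * C"]) auto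
  then show ?thesis by (simp add: a_def)
qed

context perpetuity_tail
begin

lemma measurable_g_G [measurable]: "g \<in> borel_measurable borel" "G \<in> borel_measurable borel"
  using mono_g G_mono by (auto intro!: borel_measurable_mono monoI)

lemma has_bochner_integral_small_loss:
  assumes "0 < w" "0 < \<tau>"
  shows "has_bochner_integral P (\<lambda>\<omega>. of_bool ((1 - M \<omega>) * w < \<tau>)) (exp (- g (w / \<tau>)))"
proof -
  have iff: "(1 - M \<omega>) * w < \<tau> \<longleftrightarrow> 1 - 1 / (w / \<tau>) < M \<omega>" for \<omega>
    using assms by (simp add: field_simps)
  have "P.expectation (\<lambda>\<omega>. of_bool ((1 - M \<omega>) * w < \<tau>))
      = P.expectation (indicator {\<omega> \<in> space P. 1 - 1 / (w / \<tau>) < M \<omega>})"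
    by (rule Bochner_Integration.integral_cong) (auto simp: iff indicator_def)
  also have "\<dots> = exp (- g (w / \<tau>))"
    using M_tail[of "w / \<tau>"] assms by simp
  finally show ?thesis
    by (auto simp: has_bochner_integral_iff intro!: P.integrable_const_bound[where B = 1])
qed

text \<open>
  The Lyapunov property in units of \<open>q\<close>: the level is \<open>w = z / q\<close> and the immigration \<open>Q\<close> is replaced
  by its upper bound, which is 1 in these units.
\<close>
lemma one_step_moment:
  assumes B: "0 < B" "B < optimal_rate"
  obtains w0 where "0 \<le> w0"
    and "\<And>w. w0 \<le> w \<Longrightarrow>
      (\<integral>\<^sup>+\<omega>. ennreal (exp (B * G (M \<omega> * w + 1))) \<partial>P) \<le> ennreal (exp (B * G w) / 2)"
proof -
  obtain n where n: "0 < n" and lim: "((\<lambda>w. growth_bound B n w) \<longlongrightarrow> 0) at_top"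
    using growth_bound_tendsto_0[OF B] by blast
  have "eventually (\<lambda>w. growth_bound B n w < 1 / 2) at_top"
    using lim by (rule order_tendstoD) simp
  then obtain w1 where w1: "\<And>w. w1 \<le> w \<Longrightarrow> growth_bound B n w < 1 / 2"
    by (auto simp: eventually_at_top_linorder)
  have "(\<integral>\<^sup>+\<omega>. ennreal (exp (B * G (M \<omega> * w + 1))) \<partial>P) \<le> ennreal (exp (B * G w) / 2)"
    if w: "max 2 w1 \<le> w" for w
  proof -
    define F where "F \<omega> = (\<Sum>k<n. exp (B * (1 - k / n) * g (w + 1)) * of_bool ((1 - M \<omega>) * w < real (k + 1) / real n))
      + of_bool ((1 - M \<omega>) * w < 2) + exp (- B * g (w - 1))" for \<omega>
    have "has_bochner_integral P F
        ((\<Sum>k<n. exp (B * (1 - k / n) * g (w + 1)) * exp (- g (w / (real (k + 1) / real n))))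
          + exp (- g (w / 2)) + exp (- B * g (w - 1)))"
      unfolding F_def
    proof (intro has_bochner_integral_add has_bochner_integral_sum has_bochner_integral_mult_right
        has_bochner_integral_small_loss)
      show "has_bochner_integral P (\<lambda>_. exp (- B * g (w - 1))) (exp (- B * g (w - 1)))"
        by (simp add: has_bochner_integral_iff P.prob_space)
    qed (use w n in auto)
    then have "has_bochner_integral P F (growth_bound B n w)"
      unfolding growth_bound_def mult_exp_exp by simp
    then have int: "integrable P F" and "P.expectation F = growth_bound B n w"
      by (simp_all add: has_bochner_integral_iff)
    with w1[of w] w have F_half: "P.expectation F \<le> 1 / 2" by simp
    have F_nonneg: "0 \<le> F \<omega>" for \<omega> unfolding F_def by (intro add_nonneg_nonneg sum_nonneg) auto
    have "AE \<omega> in P. exp (B * G (M \<omega> * w + 1)) \<le> exp (B * G w) * F \<omega>"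
      using M_range
    proof eventually_elim
      case (elim \<omega>)
      define v where "v = (1 - M \<omega>) * w"
      have "0 < v" "v \<le> w" using elim w by (auto simp: v_def mult_le_cancel_right1)
      then have "exp (B * (G (w + 1 - v) - G w)) \<le> F \<omega>"
        unfolding F_def v_def[symmetric] using w n B by (intro exp_increment_bound) auto
      then have "exp (B * G w) * exp (B * (G (w + 1 - v) - G w)) \<le> exp (B * G w) * F \<omega>"
        by (rule mult_left_mono) simp
      also have "exp (B * G w) * exp (B * (G (w + 1 - v) - G w)) = exp (B * G (w + 1 - v))"
        by (simp add: mult_exp_exp right_diff_distrib)
      also have "w + 1 - v = M \<omega> * w + 1" by (simp add: v_def algebra_simps)
      finally show ?case .
    qed
    then have "(\<integral>\<^sup>+\<omega>. ennreal (exp (B * G (M \<omega> * w + 1))) \<partial>P) \<le> (\<integral>\<^sup>+\<omega>. ennreal (exp (B * G w) * F \<omega>) \<partial>P)"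
      by (intro nn_integral_mono_AE) (auto intro: ennreal_leI)
    also have "\<dots> = ennreal (P.expectation (\<lambda>\<omega>. exp (B * G w) * F \<omega>))"
      using int F_nonneg by (intro nn_integral_eq_integral) auto
    also have "\<dots> \<le> ennreal (exp (B * G w) / 2)"
      using mult_left_mono[OF F_half, of "exp (B * G w)"] by (intro ennreal_leI) simp
    finally show ?thesis .
  qed
  then show thesis by (intro that[of "max 2 w1"]) auto
qed

text \<open>
  Exponential Markov inequality. The fixed-point equation and \<open>one_step_moment\<close> bound the mean of
  \<open>V R\<close> by a constant, for the starting points below \<open>w0\<close>, plus half of itself. Finiteness
  of this mean is not known beforehand, so \<open>V\<close> is truncated and \<open>truncated_mean_bound\<close> is applied.
\<close>
lemma tail_upper:
  assumes B: "0 < B" "B < optimal_rate"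
  obtains D where "\<And>x. tail x \<le> exp (D - B * G (x / q))"
proof -
  obtain w0 where w0: "0 \<le> w0" and half: "\<And>w. w0 \<le> w \<Longrightarrow>
      (\<integral>\<^sup>+\<omega>. ennreal (exp (B * G (M \<omega> * w + 1))) \<partial>P) \<le> ennreal (exp (B * G w) / 2)"
    using one_step_moment[OF B] by blast
  define V where "V z = exp (B * G (z / q))" for z
  have [measurable]: "V \<in> borel_measurable borel" unfolding V_def by measurable
  have V_pos: "0 < V z" for z by (simp add: V_def)
  have V_mono: "V x \<le> V y" if "x \<le> y" for x y
    using that q_pos B by (auto simp: V_def intro!: G_mono divide_right_mono)
  define C where "C = exp (B * G (w0 + 1))"
  have C: "0 < C" by (simp add: C_def)
  have int: "integrable N (\<lambda>\<omega>. min (V (R \<omega>)) K)" if "0 < K" for K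
    using that V_pos by (intro N.integrable_const_bound[where B = K]) (auto simp: less_imp_le)
  have nn: "(\<integral>\<^sup>+\<omega>. ennreal (min (V (R \<omega>)) K) \<partial>N) = ennreal (N.expectation (\<lambda>\<omega>. min (V (R \<omega>)) K))"
    if "0 < K" for K
    using that V_pos int by (intro nn_integral_eq_integral) (auto simp: less_imp_le)
  have inner: "(\<integral>\<^sup>+\<omega>. ennreal (min (V (M \<omega> * z + Q \<omega>)) K) \<partial>P) \<le> ennreal (C + min (V z) (2 * K) / 2)"
    if K: "0 < K" for K z
  proof -
    have V_le: "AE \<omega> in P. V (M \<omega> * z + Q \<omega>) \<le> exp (B * G (M \<omega> * (z / q) + 1))"
      using Q_le
    proof eventually_elim
      case (elim \<omega>)
      have "V (M \<omega> * z + Q \<omega>) \<le> V (M \<omega> * z + q)" using elim by (intro V_mono) simp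
      then show ?case using q_pos by (simp add: V_def add_divide_distrib)
    qed
    show ?thesis
    proof (cases "w0 \<le> z / q")
      case True
      have "(\<integral>\<^sup>+\<omega>. ennreal (min (V (M \<omega> * z + Q \<omega>)) K) \<partial>P)
          \<le> (\<integral>\<^sup>+\<omega>. ennreal (exp (B * G (M \<omega> * (z / q) + 1))) \<partial>P)"
      proof (rule nn_integral_mono_AE)
        show "AE \<omega> in P. ennreal (min (V (M \<omega> * z + Q \<omega>)) K) \<le> ennreal (exp (B * G (M \<omega> * (z / q) + 1)))"
          using V_le by eventually_elim (intro ennreal_leI min.coboundedI1)
      qed
      also have "\<dots> \<le> ennreal (V z / 2)" using half[OF True] by (simp add: V_def)
      finally have 1: "(\<integral>\<^sup>+\<omega>. ennreal (min (V (M \<omega> * z + Q \<omega>)) K) \<partial>P) \<le> ennreal (V z / 2)" .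
      have "(\<integral>\<^sup>+\<omega>. ennreal (min (V (M \<omega> * z + Q \<omega>)) K) \<partial>P) \<le> (\<integral>\<^sup>+\<omega>. ennreal K \<partial>P)"
        by (intro nn_integral_mono ennreal_leI) simp
      also have "\<dots> = ennreal K" by (simp add: P.emeasure_space_1)
      finally have "(\<integral>\<^sup>+\<omega>. ennreal (min (V (M \<omega> * z + Q \<omega>)) K) \<partial>P) \<le> ennreal (min (V z / 2) K)"
        using 1 by (simp add: min_def)
      also have "\<dots> \<le> ennreal (C + min (V z) (2 * K) / 2)"
        using C by (intro ennreal_leI) (simp add: min_def)
      finally show ?thesis .
    next
      case False
      have "AE \<omega> in P. min (V (M \<omega> * z + Q \<omega>)) K \<le> C"
        using V_le M_range
      proof eventually_elim
        case (elim \<omega>)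
        have "M \<omega> * (z / q) \<le> M \<omega> * w0" using elim False by (intro mult_left_mono) auto
        also have "\<dots> \<le> w0" using elim w0 by (simp add: mult_left_le_one_le)
        finally have "exp (B * G (M \<omega> * (z / q) + 1)) \<le> C"
          using B by (auto simp: C_def intro!: G_mono)
        with elim show ?case by simp
      qed
      then have "(\<integral>\<^sup>+\<omega>. ennreal (min (V (M \<omega> * z + Q \<omega>)) K) \<partial>P) \<le> (\<integral>\<^sup>+\<omega>. ennreal C \<partial>P)"
        by (intro nn_integral_mono_AE) (auto elim!: eventually_mono intro!: ennreal_leI)
      also have "\<dots> = ennreal C" by (simp add: P.emeasure_space_1)
      also have "\<dots> \<le> ennreal (C + min (V z) (2 * K) / 2)"
        using K V_pos[of z] by (intro ennreal_leI) simp
      finally show ?thesis .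
    qed
  qed
  have rec: "N.expectation (\<lambda>\<omega>. min (V (R \<omega>)) K) \<le> C + N.expectation (\<lambda>\<omega>. min (V (R \<omega>)) (2 * K)) / 2"
    if K: "0 < K" for K
  proof -
    have "ennreal (N.expectation (\<lambda>\<omega>. min (V (R \<omega>)) K)) = (\<integral>\<^sup>+\<omega>. ennreal (min (V (R \<omega>)) K) \<partial>N)"
      using nn[OF K] by simp
    also have "\<dots> = (\<integral>\<^sup>+\<omega>'. (\<integral>\<^sup>+\<omega>. ennreal (min (V (M \<omega> * R \<omega>' + Q \<omega>)) K) \<partial>P) \<partial>N)"
      by (rule nn_integral_fixed_point) measurable
    also have "\<dots> \<le> (\<integral>\<^sup>+\<omega>'. ennreal (C + min (V (R \<omega>')) (2 * K) / 2) \<partial>N)"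
      by (intro nn_integral_mono inner K)
    also have "\<dots> = ennreal (N.expectation (\<lambda>\<omega>'. C + min (V (R \<omega>')) (2 * K) / 2))"
      using K V_pos C int[of "2 * K"]
      by (intro nn_integral_eq_integral) (auto intro!: AE_I2 add_nonneg_nonneg simp: less_imp_le)
    also have "N.expectation (\<lambda>\<omega>'. C + min (V (R \<omega>')) (2 * K) / 2)
        = C + N.expectation (\<lambda>\<omega>'. min (V (R \<omega>')) (2 * K)) / 2"
      using K int[of "2 * K"] by (subst Bochner_Integration.integral_add) (auto simp: N.prob_space)
    finally show ?thesis
      using C K V_pos
      by (subst (asm) ennreal_le_iff) (auto intro!: add_nonneg_nonneg integral_nonneg simp: less_imp_le)
  qed
  have "tail x \<le> exp (ln (2 * C) - B * G (x / q))" for x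
  proof -
    have "V x * tail x = N.expectation (\<lambda>\<omega>. V x * indicator {\<omega> \<in> space N. x < R \<omega>} \<omega>)"
      by (simp add: tail_def)
    also have "\<dots> \<le> N.expectation (\<lambda>\<omega>. min (V (R \<omega>)) (V x))"
    proof (rule integral_mono)
      have "integrable N (indicator {\<omega> \<in> space N. x < R \<omega>} :: _ \<Rightarrow> real)"
        by (rule integrable_real_indicator) (auto simp: less_top[symmetric])
      then show "integrable N (\<lambda>\<omega>. V x * indicator {\<omega> \<in> space N. x < R \<omega>} \<omega>)" by simp
      show "V x * indicator {\<omega> \<in> space N. x < R \<omega>} \<omega> \<le> min (V (R \<omega>)) (V x)" for \<omega>
        using V_mono[of x "R \<omega>"] V_pos[of x] V_pos[of "R \<omega>"] by (auto simp: indicator_def)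
    qed (use int[OF V_pos] in auto)
    also have "\<dots> \<le> 2 * C"
      using C rec V_pos by (intro N.truncated_mean_bound) (auto simp: less_imp_le)
    finally have "tail x \<le> 2 * C / V x" using V_pos[of x] by (simp add: field_simps)
    also have "\<dots> = exp (ln (2 * C) - B * G (x / q))" using C by (simp add: V_def exp_diff)
    finally show ?thesis .
  qed
  then show thesis by (rule that)
qed

lemma tail_exponent_lower:
  assumes "0 < B" "B < optimal_rate"
  obtains D where "\<And>x. B * G (x / q) - D \<le> tail_exponent x"
proof -
  obtain D where D: "\<And>x. tail x \<le> exp (D - B * G (x / q))"
    using tail_upper[OF assms] by blast
  have "B * G (x / q) - D \<le> tail_exponent x" for x
    using ln_mono[OF D tail_pos, of x] by (simp add: tail_exponent_def)
  then show thesis by (rule that)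
qed

text \<open>
  Both bounds are compared with \<open>F y = y * g y\<close> at \<open>x = q * y\<close>. The lower one has the limit
  \<open>B / (\<rho> + 1)\<close>, where \<open>B\<close> can be any positive number below \<open>optimal_rate\<close>. The upper one, with the
  optimal \<open>u\<close> and \<open>b = q / t\<close>, has the limit \<open>t powr (\<rho> + 1) * optimal_rate / (\<rho> + 1)\<close>, where \<open>t > 1\<close> can be
  any number.
\<close>
lemma tail_exponent_asymp: "((\<lambda>x. tail_exponent x / (x / q * g (x / q))) \<longlongrightarrow> optimal_rate / (\<rho> + 1)) at_top"
proof -
  define L where "L = optimal_rate / (\<rho> + 1)"
  have L: "0 < L" using optimal_rate_pos index_pos by (simp add: L_def)
  define F where "F y = y * g y" for y
  have F_pos: "eventually (\<lambda>y. 0 < F y) at_top"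
    using g_pos eventually_gt_at_top[of 0] by eventually_elim (simp add: F_def)
  have "((\<lambda>y. tail_exponent (q * y) / F y) \<longlongrightarrow> L) at_top"
  proof (rule order_tendstoI)
    fix a assume "a < L"
    define a' where "a' = max a 0"
    have "a' < L" using \<open>a < L\<close> L by (simp add: a'_def)
    then obtain c where c: "a' < c" "c < L" using dense by blast
    define B where "B = c * (\<rho> + 1)"
    have "0 < c" using c by (simp add: a'_def)
    then have B: "0 < B" "B < optimal_rate"
      using c(2) index_pos by (auto simp: B_def L_def pos_less_divide_eq)
    obtain D where D: "\<And>x. B * G (x / q) - D \<le> tail_exponent x" using tail_exponent_lower[OF B] by blast
    have "((\<lambda>y. B * (G y / (y * g y)) - (0 * y + D) / (y * g y)) \<longlongrightarrow> B * (1 / (\<rho> + 1)) - 0) at_top"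
      by (intro tendsto_intros karamata_primitive affine_negligible)
    moreover have "a < B * (1 / (\<rho> + 1)) - 0" using c index_pos by (simp add: B_def a'_def)
    ultimately have "eventually (\<lambda>y. a < B * (G y / (y * g y)) - (0 * y + D) / (y * g y)) at_top"
      by (rule order_tendstoD)
    with F_pos show "eventually (\<lambda>y. a < tail_exponent (q * y) / F y) at_top"
    proof eventually_elim
      case (elim y)
      have "(B * G y - D) / F y \<le> tail_exponent (q * y) / F y"
        using D[of "q * y"] q_pos elim by (intro divide_right_mono) auto
      with elim show ?case by (simp add: F_def diff_divide_distrib)
    qed
  next
    fix a assume "L < a"
    have "((\<lambda>t. t powr (\<rho> + 1) * L) \<longlongrightarrow> 1 powr (\<rho> + 1) * L) (at_right 1)"
      by (intro tendsto_intros) auto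
    then have "eventually (\<lambda>t. t powr (\<rho> + 1) * L < a) (at_right 1)"
      using \<open>L < a\<close> by (intro order_tendstoD) auto
    then have "eventually (\<lambda>t. t powr (\<rho> + 1) * L < a \<and> 1 < t) (at_right 1)"
      using eventually_at_right_less by (rule eventually_conj)
    then obtain t where t: "t powr (\<rho> + 1) * L < a" "1 < t"
      using eventually_happens[of _ "at_right (1::real)"] by auto
    define u b where "u = (\<rho> + 1) / \<rho>" and "b = q / t"
    have ub: "0 < b" "b < q" "1 < u" using t q_pos index_pos by (auto simp: u_def b_def field_simps)
    obtain A D where D: "\<And>x. 1 \<le> x \<Longrightarrow> tail_exponent x \<le> G (u / b * x) / (u - 1) + A * x + D"
      using tail_exponent_upper[OF ub] by blast
    have u1: "1 / (u - 1) = \<rho>" using index_pos by (simp add: u_def field_simps)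
    have "((\<lambda>y. \<rho> * (G (u * t * y) / (y * g y)) + (A * q * y + D) / (y * g y)) \<longlongrightarrow>
        \<rho> * ((u * t) powr (\<rho> + 1) / (\<rho> + 1)) + 0) at_top"
      using t ub by (intro tendsto_intros G_scale affine_negligible) auto
    moreover have "\<rho> * ((u * t) powr (\<rho> + 1) / (\<rho> + 1)) + 0 < a"
    proof -
      have "\<rho> * u powr (\<rho> + 1) = optimal_rate"
        using index_pos by (simp add: u_def optimal_rate_def powr_divide powr_add field_simps)
      then have "\<rho> * ((u * t) powr (\<rho> + 1) / (\<rho> + 1)) = t powr (\<rho> + 1) * L"
        using t ub by (simp add: powr_mult L_def)
      with t show ?thesis by simp
    qed
    ultimately have "eventually (\<lambda>y. \<rho> * (G (u * t * y) / (y * g y)) + (A * q * y + D) / (y * g y) < a) at_top"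
      by (rule order_tendstoD)
    with F_pos eventually_ge_at_top[of "1 / q"] show "eventually (\<lambda>y. tail_exponent (q * y) / F y < a) at_top"
    proof eventually_elim
      case (elim y)
      have "1 \<le> q * y" using elim q_pos by (simp add: field_simps)
      from D[OF this] have "tail_exponent (q * y) \<le> G (u * t * y) * (1 / (u - 1)) + (A * q * y + D)"
        using q_pos t by (simp add: b_def mult.assoc)
      then have "tail_exponent (q * y) / F y \<le> (\<rho> * G (u * t * y) + (A * q * y + D)) / F y"
        unfolding u1 using elim by (intro divide_right_mono) (auto simp: mult.commute)
      with elim show ?case by (simp add: F_def add_divide_distrib)
    qed
  qed
  moreover have "filterlim (\<lambda>x. x / q) at_top at_top" using q_pos by real_asymp
  ultimately have "((\<lambda>x. tail_exponent (q * (x / q)) / F (x / q)) \<longlongrightarrow> L) at_top"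
    by (rule filterlim_compose)
  then show ?thesis using q_pos by (simp add: F_def L_def)
qed

end

section \<open>Asymptotics of the tail\<close>

theorem theorem3p2:
  fixes P :: "'a measure" and M Q :: "'a \<Rightarrow> real"
    and N :: "'b measure" and R :: "'b \<Rightarrow> real"
    and q r :: real
  assumes "prob_space P"
    and "prob_space.indep_var P borel M borel Q"
    and "\<P>(\<omega> in P. M \<omega> \<ge> 0 \<and> Q \<omega> \<ge> 0) = 1"
    and "is_perpetuity P M Q N R"
    and "esssup P (\<lambda>\<omega>. ereal (Q \<omega>)) = ereal q" and "q > 0"
    and "r > 1" and "regularly_varying r (tail_fun P M)"
  shows "(\<lambda>x. - ln \<P>(\<omega> in N. R \<omega> > x)) \<sim>[at_top]
         (\<lambda>x. (r / (r - 1)) powr (r - 1) * tail_fun P M (x / q))"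
proof -
  interpret P: prob_space P by fact
  have [measurable]: "M \<in> borel_measurable P" "Q \<in> borel_measurable P"
    using assms(4) by (simp_all add: is_perpetuity_def)
  define p where "p x = \<P>(\<omega> in P. 1 - 1 / x < M \<omega>)" for x
  define g where "g x = (if 0 < x then - ln (p x) else 0)" for x
  have tail_fun_eq: "tail_fun P M x = x * g x" if "0 < x" for x
    using that by (simp add: tail_fun_def g_def p_def)
  have p_antimono: "p y \<le> p x" if "0 < x" "x \<le> y" for x y
  proof -
    have "1 - 1 / x \<le> 1 - 1 / y" using that by (simp add: frac_le)
    then show ?thesis unfolding p_def by (intro P.finite_measure_mono) auto
  qed
  obtain a where a: "\<And>x. a < x \<Longrightarrow> 0 < tail_fun P M x"
    and lim: "\<And>t. 0 < t \<Longrightarrow> ((\<lambda>x. tail_fun P M (t * x) / tail_fun P M x) \<longlongrightarrow> t powr r) at_top"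
    using assms(8) unfolding regularly_varying_def by blast
  have p_pos: "0 < p x" if "0 < x" for x
  proof -
    define y where "y = max x (max a 0 + 1)"
    have y: "a < y" "0 < y" "x \<le> y" by (auto simp: y_def)
    have "ln (p y) \<noteq> 0" using a[OF y(1)] by (auto simp: tail_fun_def p_def)
    then have "p y \<noteq> 0" by auto
    then have "0 < p y" by (simp add: p_def zero_less_measure_iff)
    with p_antimono[OF that y(3)] show ?thesis by simp
  qed
  have p_le_1: "p x \<le> 1" for x by (simp add: p_def)
  have g_nonneg: "0 \<le> g x" for x
    using p_pos[of x] p_le_1[of x] by (simp add: g_def)
  interpret increasing_regvar g "r - 1"
  proof
    show "mono g"
    proof (rule monoI)
      fix x y :: real assume "x \<le> y"
      show "g x \<le> g y"
      proof (cases "0 < x")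
        case True
        then show ?thesis
          using \<open>x \<le> y\<close> p_antimono[OF True \<open>x \<le> y\<close>] p_pos by (simp add: g_def)
      next
        case False
        then show ?thesis using g_nonneg[of y] by (simp add: g_def)
      qed
    qed
    show "0 < r - 1" using assms by simp
    show "eventually (\<lambda>x. 0 < g x) at_top"
      using eventually_gt_at_top[of a] eventually_gt_at_top[of 0]
    proof eventually_elim
      case (elim x)
      with a[of x] show ?case by (simp add: tail_fun_eq zero_less_mult_iff)
    qed
    fix t :: real assume t: "0 < t"
    have "((\<lambda>x. tail_fun P M (t * x) / tail_fun P M x / t) \<longlongrightarrow> t powr r / t) at_top"
      using t by (intro tendsto_intros lim) auto
    moreover have "eventually (\<lambda>x. tail_fun P M (t * x) / tail_fun P M x / t = g (t * x) / g x) at_top"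
      using eventually_gt_at_top[of 0]
      by eventually_elim (use t in \<open>simp add: tail_fun_eq\<close>)
    ultimately show "((\<lambda>x. g (t * x) / g x) \<longlongrightarrow> t powr (r - 1)) at_top"
      using t by (auto intro: Lim_transform_eventually simp: powr_diff)
  qed (rule g_nonneg)
  have M_tail: "p x = exp (- g x)" if "0 < x" for x
    using that p_pos by (simp add: g_def)
  have "AE \<omega> in P. 0 \<le> M \<omega> \<and> 0 \<le> Q \<omega>"
    using assms(3) P.prob_eq_1[of "{\<omega> \<in> space P. M \<omega> \<ge> 0 \<and> Q \<omega> \<ge> 0}"] by simp
  \<comment> \<open>Regular variation with \<open>r > 1\<close> forces \<open>g\<close> to infinity, which excludes \<open>M \<ge> 1\<close>.\<close>
  moreover have "AE \<omega> in P. M \<omega> < 1"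
  proof -
    have "((\<lambda>x. exp (- g x)) \<longlongrightarrow> 0) at_top"
      using g_at_top by (intro filterlim_compose[OF exp_at_bot]) (simp add: filterlim_uminus_at_bot)
    moreover have "eventually (\<lambda>x. \<P>(\<omega> in P. 1 \<le> M \<omega>) \<le> exp (- g x)) at_top"
      using eventually_gt_at_top[of 0]
    proof eventually_elim
      case (elim x)
      have "\<P>(\<omega> in P. 1 \<le> M \<omega>) \<le> p x"
        unfolding p_def
        using elim by (intro P.finite_measure_mono) (auto intro: less_le_trans[rotated])
      then show ?case using M_tail[OF elim] by simp
    qed
    ultimately have "\<P>(\<omega> in P. 1 \<le> M \<omega>) \<le> 0"
      by (rule tendsto_lowerbound) simp
    then have "\<P>(\<omega> in P. 1 \<le> M \<omega>) = 0" by (simp add: measure_le_0_iff)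
    then show ?thesis
      using P.prob_eq_0[of "{\<omega> \<in> space P. 1 \<le> M \<omega>}"] by (simp add: not_le)
  qed
  ultimately have M_range: "AE \<omega> in P. 0 \<le> M \<omega> \<and> M \<omega> < 1" by eventually_elim simp
  have Q_le: "AE \<omega> in P. Q \<omega> \<le> q"
    using esssup_AE[of "\<lambda>\<omega>. ereal (Q \<omega>)" P] assms(5) by simp
  have Q_tail: "0 < \<P>(\<omega> in P. b < Q \<omega>)" if "b < q" for b
    using esssup_pos_measure[of "\<lambda>\<omega>. ereal (Q \<omega>)" P "ereal b"] assms(5) that
    by (simp add: P.emeasure_eq_measure)
  interpret perpetuity_tail g "r - 1" P M Q N R q
    using assms M_range M_tail Q_le Q_tail by unfold_locales (simp_all add: p_def)
  have rate: "optimal_rate / r = (r / (r - 1)) powr (r - 1)"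
  proof -
    have "r powr r = r powr (r - 1) * r"
      using \<open>r > 1\<close> powr_add[of r "r - 1" 1] by simp
    then show ?thesis
      using \<open>r > 1\<close> by (simp add: optimal_rate_def powr_divide)
  qed
  have "(\<lambda>x. - ln \<P>(\<omega> in N. R \<omega> > x)) \<sim>[at_top]
      (\<lambda>x. (r / (r - 1)) powr (r - 1) * (x / q * g (x / q)))"
    using tail_exponent_asymp \<open>r > 1\<close> unfolding rate[symmetric]
    by (intro asymp_equivI'_const) (use optimal_rate_pos in \<open>simp_all add: tail_exponent_def tail_def\<close>)
  also have "(\<lambda>x. (r / (r - 1)) powr (r - 1) * (x / q * g (x / q))) \<sim>[at_top]
      (\<lambda>x. (r / (r - 1)) powr (r - 1) * tail_fun P M (x / q))"
  proof (rule asymp_equiv_refl_ev)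
    show "eventually (\<lambda>x. (r / (r - 1)) powr (r - 1) * (x / q * g (x / q))
        = (r / (r - 1)) powr (r - 1) * tail_fun P M (x / q)) at_top"
      using eventually_gt_at_top[of 0]
      by eventually_elim (use \<open>q > 0\<close> in \<open>simp add: tail_fun_eq\<close>)
  qed
  finally show ?thesis .
qed

end
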